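(* Let $\theta$ be an action of an inverse semigroup $S$ on a locally compact Hausdorff space $X$. Then the KS-groupoid $S\ltimes X^{\mathrm{KS}}$ is second countable if and only if $X$ is second countable and $S^X=\{s\in S\mid X_{s^*s}\neq\emptyset\}$ is countable.
   Context: An inverse semigroup is a semigroup $S$ in which every $s$ has a unique $s^*$ with $ss^*s=s$, $s^*ss^*=s^*$; $E(S)$ is its commutative subsemigroup of idempotents; $s\le t$ means $ts^*s=s$. An action $\theta$ of $S$ on a topological space $X$ is a semigroup homomorphism $s\mapsto\theta_s$ from $S$ to the inverse semigroup of partial bijections of $X$ (bijections between subsets, composed on the largest possible domain) such that, writing $X_e$ for the subset on which $\theta_e$ ($e\in E(S)$) is the identity (so $\theta_s$ is a bijection $X_{s^*s}\to X_{ss^*}$): each $X_e$ is open, each $\theta_s\colon X_{s^*s}\to X_{ss^*}$ is continuous, and $\bigcup_{e\in E(S)}X_e=X$. The space $X^{\mathrm{KS}}$: let $\widetilde{X_e}=X_e\sqcup\{\infty_e\}$ be the one-point compactification of $X_e$ (a point $\infty_e$ is added even when $X_e$ is compact). Let $\widetilde{X^{\mathrm{KS}}}$ be the set of $\tau\in\prod_{e\in E(S)}\widetilde{X_e}$ such that (1) if $e_1\le e_2$ and $\tau(e_1)\ne\infty_{e_1}$, then $\tau(e_2)=\tau(e_1)$; (2) if $\tau(e_1)\neq\infty_{e_1}$ and $\tau(e_2)\neq\infty_{e_2}$, then $\tau(e_1e_2)\neq\infty_{e_1e_2}$; with the topology induced from the product topology. Set $X^{\mathrm{KS}}=\widetilde{X^{\mathrm{KS}}}\setminus\{\infty\}$,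 $\infty=(\infty_e)_e$; it is locally compact Hausdorff. $S$ acts on $X^{\mathrm{KS}}$ by $X^{\mathrm{KS}}_e=\{\tau\in X^{\mathrm{KS}}\mid\tau(e)\ne\infty_e\}$ and $\theta^{\mathrm{KS}}_s\colon X^{\mathrm{KS}}_{s^*s}\to X^{\mathrm{KS}}_{ss^*}$, $\theta^{\mathrm{KS}}_s(\tau)(e)=\theta_{es}(\tau(s^*es))$ if $\tau(s^*es)\neq\infty_{s^*es}$ and $\infty_e$ otherwise. Transformation groupoid: for an action $\theta$ of $S$ on a locally compact Hausdorff space $Z$, $S\ltimes Z$ is the set of classes $[s,z]$ of pairs $(s,z)$, $z\in Z_{s^*s}$, under $(s,z)\sim(t,w)$ iff $z=w$ and $se=te$, $z\in Z_e$ for some $e\in E(S)$; unit space $\{[e,z]\}\cong Z$, $d([s,z])=z$, $r([s,z])=\theta_s(z)$, $[t,\theta_s(z)][s,z]=[ts,z]$, $[s,z]^{-1}=[s^*,\theta_s(z)]$; basis of open sets $[s,U]=\{[s,z]\mid z\in U\}$, $U\subset Z_{s^*s}$ open. The KS-groupoid is the transformation groupoid $S\ltimes X^{\mathrm{KS}}$ of the action $\theta^{\mathrm{KS}}=(\theta^{\mathrm{KS}}_s)_{s\in S}$ of $S$ on $Z=X^{\mathrm{KS}}$, with $Z_e=X^{\mathrm{KS}}_e$ for $e\in E(S)$. *)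

theory Defs
  imports "HOL-Analysis.Analysis"
begin

class inverse_semigroup = semigroup_mult +
  assumes ex1_generalized_inverse: "\<exists>!t. s * t * s = s \<and> t * s * t = t"

definition star :: "'s::inverse_semigroup \<Rightarrow> 's" (\<open>_\<^sup>\<star>\<close> [1000] 999)
  where "s\<^sup>\<star> = (THE t. s * t * s = s \<and> t * s * t = t)"

definition idempotents :: "'s::inverse_semigroup set"
  where "idempotents = {e. e * e = e}"

definition nat_le :: "'s::inverse_semigroup \<Rightarrow> 's \<Rightarrow> bool" (infix \<open>\<preceq>\<close> 50)
  where "s \<preceq> t \<longleftrightarrow> t * s\<^sup>\<star> * s = s"

(* A partial bijection is a partial map; \<circ>\<^sub>m composes partial maps on the largest possible domain. *)
definition partial_bijection :: "'x set \<Rightarrow> ('x \<rightharpoonup> 'x) \<Rightarrow> bool"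
  where "partial_bijection A f \<longleftrightarrow> dom f \<subseteq> A \<and> ran f \<subseteq> A \<and> inj_on f (dom f)"

definition fixed_part :: "('s \<Rightarrow> 'x \<rightharpoonup> 'x) \<Rightarrow> 's \<Rightarrow> 'x set"
  where "fixed_part \<theta> e = {x. \<theta> e x = Some x}"

definition is_action :: "'x topology \<Rightarrow> ('s::inverse_semigroup \<Rightarrow> 'x \<rightharpoonup> 'x) \<Rightarrow> bool"
  where "is_action X \<theta> \<longleftrightarrow>
    (\<forall>s. partial_bijection (topspace X) (\<theta> s)) \<and>
    (\<forall>s t. \<theta> (s * t) = \<theta> s \<circ>\<^sub>m \<theta> t) \<and>
    (\<forall>e\<in>idempotents. openin X (fixed_part \<theta> e)) \<and>
    (\<forall>s. continuous_map (subtopology X (fixed_part \<theta> (s\<^sup>\<star> * s)))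
                        (subtopology X (fixed_part \<theta> (s * s\<^sup>\<star>)))
                        (\<lambda>x. the (\<theta> s x))) \<and>
    (\<Union>e\<in>idempotents. fixed_part \<theta> e) = topspace X"

(* The point at infinity of each compactification is None. Alexandroff_compactification adds it even
   when the space is already compact; it is then an isolated point. *)
definition KS_product ::
    "'x topology \<Rightarrow> ('s::inverse_semigroup \<Rightarrow> 'x \<rightharpoonup> 'x) \<Rightarrow> ('s \<Rightarrow> 'x option) topology"
  where "KS_product X \<theta> =
    product_topology (\<lambda>e. Alexandroff_compactification (subtopology X (fixed_part \<theta> e))) idempotents"

definition KS_tilde ::
    "'x topology \<Rightarrow> ('s::inverse_semigroup \<Rightarrow> 'x \<rightharpoonup> 'x) \<Rightarrow> ('s \<Rightarrow> 'x option) set"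
  where "KS_tilde X \<theta> = {\<tau> \<in> topspace (KS_product X \<theta>).
    (\<forall>e1\<in>idempotents. \<forall>e2\<in>idempotents. e1 \<preceq> e2 \<and> \<tau> e1 \<noteq> None \<longrightarrow> \<tau> e2 = \<tau> e1) \<and>
    (\<forall>e1\<in>idempotents. \<forall>e2\<in>idempotents.
       \<tau> e1 \<noteq> None \<and> \<tau> e2 \<noteq> None \<longrightarrow> \<tau> (e1 * e2) \<noteq> None)}"

definition KS_infinity :: "'s::inverse_semigroup \<Rightarrow> 'x option"
  where "KS_infinity = (\<lambda>e\<in>idempotents. None)"

definition KS_space ::
    "'x topology \<Rightarrow> ('s::inverse_semigroup \<Rightarrow> 'x \<rightharpoonup> 'x) \<Rightarrow> ('s \<Rightarrow> 'x option) topology"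
  where "KS_space X \<theta> = subtopology (KS_product X \<theta>) (KS_tilde X \<theta> - {KS_infinity})"

definition KS_action ::
    "'x topology \<Rightarrow> ('s::inverse_semigroup \<Rightarrow> 'x \<rightharpoonup> 'x)
      \<Rightarrow> 's \<Rightarrow> ('s \<Rightarrow> 'x option) \<rightharpoonup> ('s \<Rightarrow> 'x option)"
  where "KS_action X \<theta> s \<tau> =
    (if \<tau> \<in> topspace (KS_space X \<theta>) \<and> \<tau> (s\<^sup>\<star> * s) \<noteq> None
     then Some (\<lambda>e\<in>idempotents.
            case \<tau> (s\<^sup>\<star> * e * s) of None \<Rightarrow> None | Some x \<Rightarrow> \<theta> (e * s) x)
     else None)"

(* Source and range take values in the space acted upon, identified with the unit space. *)
record ('g, 'z) topological_groupoid =
  arrows :: "'g topology"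
  source :: "'g \<Rightarrow> 'z"
  range_of :: "'g \<Rightarrow> 'z"
  product :: "'g \<Rightarrow> 'g \<Rightarrow> 'g"
  inverse_of :: "'g \<Rightarrow> 'g"

definition germ_pairs :: "('s::inverse_semigroup \<Rightarrow> 'z \<rightharpoonup> 'z) \<Rightarrow> ('s \<times> 'z) set"
  where "germ_pairs \<theta> = {(s, z). z \<in> fixed_part \<theta> (s\<^sup>\<star> * s)}"

definition germ_rel :: "('s::inverse_semigroup \<Rightarrow> 'z \<rightharpoonup> 'z) \<Rightarrow> (('s \<times> 'z) \<times> ('s \<times> 'z)) set"
  where "germ_rel \<theta> = {((s, z), (t, w)). (s, z) \<in> germ_pairs \<theta> \<and> (t, w) \<in> germ_pairs \<theta> \<and>
    z = w \<and> (\<exists>e\<in>idempotents. s * e = t * e \<and> z \<in> fixed_part \<theta> e)}"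

definition germ :: "('s::inverse_semigroup \<Rightarrow> 'z \<rightharpoonup> 'z) \<Rightarrow> 's \<Rightarrow> 'z \<Rightarrow> ('s \<times> 'z) set"
  where "germ \<theta> s z = germ_rel \<theta> `` {(s, z)}"

(* The topology below has the sets [s, U] as a basis, and its underlying set is
   the set of all classes, since U may be all of fixed_part \<theta> (s\<^sup>\<star> * s). *)
definition transformation_groupoid ::
    "'z topology \<Rightarrow> ('s::inverse_semigroup \<Rightarrow> 'z \<rightharpoonup> 'z) \<Rightarrow> (('s \<times> 'z) set, 'z) topological_groupoid"
  where "transformation_groupoid Z \<theta> = \<lparr>
    arrows = topology_generated_by
      {germ \<theta> s ` U | s U. openin Z U \<and> U \<subseteq> fixed_part \<theta> (s\<^sup>\<star> * s)},
    source = (\<lambda>g. THE z. \<exists>s. (s, z) \<in> g),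
    range_of = (\<lambda>g. THE y. \<exists>s z. (s, z) \<in> g \<and> \<theta> s z = Some y),
    product = (\<lambda>h g. THE k. \<exists>t s z y. (s, z) \<in> g \<and> \<theta> s z = Some y \<and> (t, y) \<in> h \<and>
                 k = germ \<theta> (t * s) z),
    inverse_of = (\<lambda>g. THE k. \<exists>s z y. (s, z) \<in> g \<and> \<theta> s z = Some y \<and> k = germ \<theta> (s\<^sup>\<star>) y)\<rparr>"

definition KS_groupoid ::
    "'x topology \<Rightarrow> ('s::inverse_semigroup \<Rightarrow> 'x \<rightharpoonup> 'x)
      \<Rightarrow> (('s \<times> ('s \<Rightarrow> 'x option)) set, 's \<Rightarrow> 'x option) topological_groupoid"
  where "KS_groupoid X \<theta> = transformation_groupoid (KS_space X \<theta>) (KS_action X \<theta>)"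

end

theory Submission
  imports Defs
begin

text \<open>
  Write $Z$ for $X^{KS}$ and $G$ for the groupoid $S \ltimes Z$.

  Suppose that $G$ is second countable. The source map $G \to Z$ is a surjective local
  homeomorphism, so $Z$ is second countable (\<open>second_countable_units\<close>). The space $X$ is a retract
  of $Z$ (\<open>retraction_KS_space\<close>): a point $x$ goes to the $\tau$ with $\tau(e) = x$ exactly when
  $x \in X_e$, and a point $\tau$ of $Z$ goes back to the common value of its finite coordinates.
  Hence $X$ is second countable too. For the countability of $S^X$, choose for each $s \in S^X$ a
  point $x \in X_{s^*s}$ and let $\tau_s$ take the value $x$ at the idempotents above $s^*s$ and
  $\infty$ at all others. This $\tau_s$ lies in $Z_f$ only if $s^*s \le f$, and so the germ of $s$ at
  $\tau_s$ lies in the bisection $[t, Z_{t^*t}]$ only if $s \le t$. Choose a member of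
  a countable base that contains this germ and is contained in $[s, Z_{s^*s}]$. If the choices for
  $s$ and $t$ coincide, then $s \le t$ and $t \le s$, so the choice is injective
  (\<open>countable_if_principal_points\<close>).

  Conversely, let $X$ be second countable and $S^X$ countable. Each $X_e$ is then a second countable
  locally compact Hausdorff space, and so its one-point compactification is second countable
  (\<open>second_countable_Alexandroff_compactification\<close>). When $e \notin S^X$ this compactification is a
  single point, so $Z$ lies in a product with only countably many nontrivial factors, and such a
  product is second countable (\<open>second_countable_product_topology\<close>). Finally, $G$ is covered by the
  countably many open bisections $[s, Z_{s^*s}]$ with $s \in S^X$, each of which is a copy of an open
  subset of $Z$ (\<open>second_countable_arrows\<close>).
\<close>

section \<open>Inverse semigroups\<close>

lemma star_inverse:
  fixes s :: "'s::inverse_semigroup"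
  shows "s * s\<^sup>\<star> * s = s" and "s\<^sup>\<star> * s * s\<^sup>\<star> = s\<^sup>\<star>"
  using theI'[OF ex1_generalized_inverse[of s]] unfolding star_def by auto

lemma star_unique:
  fixes s :: "'s::inverse_semigroup"
  assumes "s * t * s = s" and "t * s * t = t"
  shows "s\<^sup>\<star> = t"
  using assms star_inverse[of s] ex1_generalized_inverse[of s] by blast

lemma star_idempotent:
  assumes "e \<in> idempotents"
  shows "e\<^sup>\<star> = e"
  using assms by (intro star_unique) (simp_all add: idempotents_def)

lemma star_mult_idempotent: "s\<^sup>\<star> * s \<in> idempotents"
  by (simp add: idempotents_def star_inverse mult.assoc[symmetric])

text \<open>
  If \<open>x\<close> is the inverse of \<open>e * f\<close>, then \<open>f * x * e\<close> is an inverse of \<open>e * f\<close> as well, so it equals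
  \<open>x\<close>. This makes \<open>x\<close> idempotent, hence its own inverse; but \<open>e * f\<close> is also an inverse of \<open>x\<close>.
\<close>

lemma idempotents_mult_closed:
  fixes e f :: "'s::inverse_semigroup"
  assumes "e \<in> idempotents" and "f \<in> idempotents"
  shows "e * f \<in> idempotents"
proof -
  have ee: "e * e = e" "e * (e * a) = e * a" and ff: "f * f = f" "f * (f * a) = f * a" for a
    using assms by (simp_all add: idempotents_def mult.assoc[symmetric])
  define x where "x = (e * f)\<^sup>\<star>"
  have efx: "e * (f * (x * (e * f))) = e * f" and xef: "x * (e * (f * x)) = x"
    using star_inverse[of "e * f"] by (simp_all add: x_def mult.assoc)
  have xefa: "x * (e * (f * (x * a))) = x * a" for a
    using xef by (metis mult.assoc)
  have "x = f * (x * e)"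
    unfolding x_def
  proof (rule star_unique, fold x_def)
    show "e * f * (f * (x * e)) * (e * f) = e * f"
      by (simp add: mult.assoc ee ff efx)
    show "f * (x * e) * (e * f) * (f * (x * e)) = f * (x * e)"
      by (simp add: mult.assoc ee ff xefa)
  qed
  then have "x * x = x"
    using xef xefa by (metis mult.assoc)
  then have "x\<^sup>\<star> = x"
    by (intro star_unique) simp_all
  moreover have "x\<^sup>\<star> = e * f"
    by (rule star_unique) (simp_all add: mult.assoc efx xef)
  ultimately show ?thesis
    using \<open>x * x = x\<close> by (simp add: idempotents_def)
qed

text \<open>
  Both \<open>f * e\<close> and the idempotent \<open>e * f\<close> itself are inverses of \<open>e * f\<close>.
\<close>

lemma idempotents_commute:
  fixes e f :: "'s::inverse_semigroup"
  assumes "e \<in> idempotents" and "f \<in> idempotents"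
  shows "e * f = f * e"
proof -
  have ee: "e * e = e" "e * (e * a) = e * a" and ff: "f * f = f" "f * (f * a) = f * a" for a
    using assms by (simp_all add: idempotents_def mult.assoc[symmetric])
  have ef: "e * (f * (e * f)) = e * f" and fe: "f * (e * (f * e)) = f * e"
    using idempotents_mult_closed[OF assms] idempotents_mult_closed[OF assms(2,1)]
    by (simp_all add: idempotents_def mult.assoc)
  have "(e * f)\<^sup>\<star> = f * e"
    by (rule star_unique) (simp_all add: mult.assoc ee ff ef fe)
  moreover have "(e * f)\<^sup>\<star> = e * f"
    by (intro star_idempotent idempotents_mult_closed assms)
  ultimately show ?thesis
    by simp
qed

lemma nat_le_idempotent:
  assumes "e \<in> idempotents"
  shows "e \<preceq> f \<longleftrightarrow> f * e = e"
  using assms star_idempotent[OF assms] by (simp add: nat_le_def idempotents_def mult.assoc)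

lemma idempotents_mult_nat_le:
  assumes "e \<in> idempotents" and "f \<in> idempotents"
  shows "e * f \<preceq> e" and "e * f \<preceq> f"
proof -
  have e: "e * (e * f) = e * f" and f: "f * (f * e) = f * e"
    using assms by (simp_all add: idempotents_def mult.assoc[symmetric])
  show "e * f \<preceq> e"
    using e by (simp add: nat_le_idempotent idempotents_mult_closed assms)
  show "e * f \<preceq> f"
    unfolding idempotents_commute[OF assms]
    using f by (simp add: nat_le_idempotent idempotents_mult_closed assms)
qed

lemma star_mult_self_idempotent:
  assumes "e \<in> idempotents"
  shows "e\<^sup>\<star> * e = e"
  using assms star_idempotent[OF assms] by (simp add: idempotents_def)


section \<open>Second countability of compactifications and products\<close>

text \<open>
  Only the neighbourhoods of the point at infinity need an argument. The members of a base with
  compact closure cover the space, so every compact set lies in the union of finitely many of their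
  closures. The complements of these finite unions form a countable neighbourhood base at infinity.
\<close>

lemma second_countable_Alexandroff_compactification:
  assumes lc: "locally_compact_space Y" and haus: "Hausdorff_space Y" and sc: "second_countable Y"
  shows "second_countable (Alexandroff_compactification Y)"
proof -
  obtain B where B: "countable B" "\<And>V. V \<in> B \<Longrightarrow> openin Y V"
    and base: "\<And>U x. openin Y U \<Longrightarrow> x \<in> U \<Longrightarrow> \<exists>V\<in>B. x \<in> V \<and> V \<subseteq> U"
    using sc unfolding second_countable_def by metis
  define B' where "B' = {V \<in> B. compactin Y (Y closure_of V)}"
  define N where "N F = insert None (Some ` (topspace Y - (\<Union>V\<in>F. Y closure_of V)))" for F
  let ?base = "(image Some) ` B \<union> N ` {F. finite F \<and> F \<subseteq> B'}"
  have "countable B'"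
    using B by (simp add: B'_def)
  have cover: "\<exists>V\<in>B'. c \<in> V" if c: "c \<in> topspace Y" for c
  proof -
    obtain U K where UK: "openin Y U" "compactin Y K" "c \<in> U" "U \<subseteq> K"
      using lc c unfolding locally_compact_space_def by metis
    obtain V where V: "V \<in> B" "c \<in> V" "V \<subseteq> U"
      using base UK by metis
    have "closedin Y K"
      using compactin_imp_closedin haus UK by blast
    then have "Y closure_of V \<subseteq> K"
      using V UK by (meson closure_of_minimal order_trans)
    then have "compactin Y (Y closure_of V)"
      using closed_compactin[OF UK(2)] by simp
    then show ?thesis
      using V unfolding B'_def by blast
  qed
  have N_open: "openin (Alexandroff_compactification Y) (N F)" if "finite F" "F \<subseteq> B'" for F
  proof -
    have "compactin Y (\<Union>V\<in>F. Y closure_of V)"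
      using that unfolding B'_def by (intro compactin_Union) auto
    moreover have "closedin Y (\<Union>V\<in>F. Y closure_of V)"
      using that by (intro closedin_Union) auto
    ultimately show ?thesis
      unfolding openin_Alexandroff_compactification N_def by blast
  qed
  have near: "\<exists>V\<in>?base. a \<in> V \<and> V \<subseteq> W"
    if W: "openin (Alexandroff_compactification Y) W" and a: "a \<in> W" for W a
  proof (cases a)
    case (Some y)
    obtain U where U: "openin Y U" "y \<in> U" "Some ` U \<subseteq> W"
    proof -
      from W consider U where "openin Y U" "W = Some ` U"
        | C where "compactin Y C" "closedin Y C" "W = insert None (Some ` (topspace Y - C))"
        unfolding openin_Alexandroff_compactification by blast
      then show ?thesis
        using that a Some by cases blast+
    qed
    then obtain V where "V \<in> B" "y \<in> V" "V \<subseteq> U"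
      using base by metis
    then show ?thesis
      using U Some by (intro bexI[of _ "Some ` V"]) auto
  next
    case None
    then obtain C where C: "compactin Y C" "W = insert None (Some ` (topspace Y - C))"
      using W a unfolding openin_Alexandroff_compactification by blast
    have "C \<subseteq> \<Union>B'"
      using cover compactin_subset_topspace[OF C(1)] by blast
    then obtain F where F: "finite F" "F \<subseteq> B'" "C \<subseteq> \<Union>F"
      using C(1) B(2) unfolding compactin_def B'_def by (metis (no_types, lifting) mem_Collect_eq)
    have sub: "V \<subseteq> Y closure_of V" if "V \<in> F" for V
      using that F(2) B(2) by (auto simp: B'_def intro!: closure_of_subset openin_subset)
    have "C \<subseteq> (\<Union>V\<in>F. Y closure_of V)"
    proof
      fix c assume "c \<in> C"
      then obtain V where "V \<in> F" "c \<in> V"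
        using F(3) by auto
      then show "c \<in> (\<Union>V\<in>F. Y closure_of V)"
        using sub[of V] by auto
    qed
    then have "N F \<subseteq> W"
      unfolding C(2) N_def by (intro insert_mono image_mono Diff_mono subset_refl)
    then show ?thesis
      using F None by (intro bexI[of _ "N F"]) (auto simp: N_def)
  qed
  have ctbl: "countable ?base"
    using \<open>countable B\<close> countable_Collect_finite_subset[OF \<open>countable B'\<close>] by simp
  have opens: "\<forall>V\<in>?base. openin (Alexandroff_compactification Y) V"
    using N_open B(2) by auto
  show ?thesis
    unfolding second_countable_def
  proof (intro exI[of _ ?base] conjI allI impI)
    show "\<exists>V\<in>?base. a \<in> V \<and> V \<subseteq> W"
      if "openin (Alexandroff_compactification Y) W \<and> a \<in> W" for W a
      using near that by (elim conjE)
  qed (fact ctbl opens)+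
qed

text \<open>
  Factors with at most one point do not contribute to the topology, so the index set itself may be
  uncountable: the cylinders over basic sets in the remaining coordinates form a countable subbase.
\<close>

lemma second_countable_product_topology:
  assumes sc: "\<And>i. i \<in> I \<Longrightarrow> second_countable (T i)"
    and nontriv: "countable {i \<in> I. \<nexists>a. topspace (T i) \<subseteq> {a}}"
  shows "second_countable (product_topology T I)"
proof -
  define J where "J = {i \<in> I. \<nexists>a. topspace (T i) \<subseteq> {a}}"
  have "\<forall>i\<in>I. \<exists>B. countable B \<and> (\<forall>V\<in>B. openin (T i) V) \<and>
             (\<forall>U x. openin (T i) U \<and> x \<in> U \<longrightarrow> (\<exists>V\<in>B. x \<in> V \<and> V \<subseteq> U))"
    using sc unfolding second_countable_def by blast
  then obtain B where B: "\<And>i. i \<in> I \<Longrightarrow> countable (B i)" "\<And>i V. i \<in> I \<Longrightarrow> V \<in> B i \<Longrightarrow> openin (T i) V"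
    and base: "\<And>i U x. i \<in> I \<Longrightarrow> openin (T i) U \<Longrightarrow> x \<in> U \<Longrightarrow> \<exists>V\<in>B i. x \<in> V \<and> V \<subseteq> U"
    by metis
  define P where "P = product_topology T I"
  have topP: "topspace P = (\<Pi>\<^sub>E i\<in>I. topspace (T i))"
    by (simp add: P_def)
  define cyl where "cyl = (\<lambda>(i, V). {f \<in> topspace P. f i \<in> V})"
  define box where "box F = topspace P \<inter> \<Inter>(cyl ` F)" for F
  let ?\<F> = "{F. finite F \<and> F \<subseteq> Sigma J B}"
  have "countable (Sigma J B)"
    using nontriv B(1) by (intro countable_SIGMA) (auto simp: J_def)
  then have ctbl: "countable (box ` ?\<F>)"
    using countable_Collect_finite_subset by blast
  have cyl_open: "openin P (cyl p)" if p: "p \<in> Sigma J B" for p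
  proof -
    obtain i V where iV: "p = (i, V)" "i \<in> I" "openin (T i) V"
      using p B(2) by (auto simp: J_def)
    show ?thesis
      using openin_continuous_map_preimage[OF continuous_map_product_projection[OF iV(2), of T] iV(3)]
      by (simp add: cyl_def iV P_def)
  qed
  have opens: "openin P (box F)" if F: "finite F" "F \<subseteq> Sigma J B" for F
    unfolding box_def using F
  proof (induction F rule: finite_induct)
    case (insert p F)
    have "topspace P \<inter> \<Inter>(cyl ` insert p F) = cyl p \<inter> (topspace P \<inter> \<Inter>(cyl ` F))"
      by auto
    then show ?case
      using insert cyl_open by (simp add: openin_Int)
  qed simp
  have near: "\<exists>V\<in>box ` ?\<F>. f \<in> V \<and> V \<subseteq> U" if U: "openin P U" and f: "f \<in> U" for U f
  proof -
    have "\<exists>X. f \<in> (\<Pi>\<^sub>E i\<in>I. X i) \<and> (\<forall>i. openin (T i) (X i)) \<and>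
        finite {i. X i \<noteq> topspace (T i)} \<and> (\<Pi>\<^sub>E i\<in>I. X i) \<subseteq> U"
      using product_topology_open_contains_basis[of T I U f] U f unfolding P_def by blast
    then obtain X where X: "f \<in> (\<Pi>\<^sub>E i\<in>I. X i)" "\<And>i. openin (T i) (X i)"
        "finite {i. X i \<noteq> topspace (T i)}" "(\<Pi>\<^sub>E i\<in>I. X i) \<subseteq> U"
      by blast
    define K where "K = J \<inter> {i. X i \<noteq> topspace (T i)}"
    have fX: "f i \<in> X i" if "i \<in> I" for i
      using X(1) that by auto
    have "\<exists>V\<in>B i. f i \<in> V \<and> V \<subseteq> X i" if "i \<in> K" for i
    proof -
      have "i \<in> I"
        using that by (simp add: K_def J_def)
      then show ?thesis
        using base[OF _ X(2) fX] by blast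
    qed
    then obtain V where V: "\<And>i. i \<in> K \<Longrightarrow> V i \<in> B i \<and> f i \<in> V i \<and> V i \<subseteq> X i"
      by metis
    define F where "F = (\<lambda>i. (i, V i)) ` K"
    have ftop: "f \<in> topspace P"
      using U f openin_subset by blast
    have "F \<in> ?\<F>"
      using X(3) V unfolding F_def K_def by auto
    moreover have "f \<in> box F"
      using ftop V by (auto simp: box_def F_def cyl_def)
    moreover have "box F \<subseteq> (\<Pi>\<^sub>E i\<in>I. X i)"
    proof
      fix g assume g: "g \<in> box F"
      then have gP: "g \<in> topspace P" and gV: "\<And>i. i \<in> K \<Longrightarrow> g i \<in> V i"
        by (auto simp: box_def F_def cyl_def)
      have "g i \<in> X i" if i: "i \<in> I" for i
      proof (cases "i \<in> J")
        case True
        show ?thesis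
        proof (cases "X i = topspace (T i)")
          case False
          then show ?thesis
            using True gV[of i] V[of i] by (auto simp: K_def)
        qed (use gP i topP in auto)
      next
        case False
        \<comment> \<open>A factor with at most one point imposes no condition: there \<open>g\<close> agrees with \<open>f\<close>.\<close>
        then obtain a where "topspace (T i) \<subseteq> {a}"
          using i by (auto simp: J_def)
        moreover have "g i \<in> topspace (T i)" "f i \<in> topspace (T i)"
          using gP ftop i by (auto simp: topP)
        ultimately have "g i = f i"
          by blast
        then show ?thesis
          using fX i by simp
      qed
      then show "g \<in> (\<Pi>\<^sub>E i\<in>I. X i)"
        using gP by (auto simp: topP PiE_def)
    qed
    ultimately show ?thesis
      using X(4) by blast
  qed
  show ?thesis
    unfolding second_countable_def P_def[symmetric]
  proof (intro exI[of _ "box ` ?\<F>"] conjI allI impI)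
    show "\<forall>V\<in>box ` ?\<F>. openin P V"
      using opens by auto
    show "\<exists>V\<in>box ` ?\<F>. f \<in> V \<and> V \<subseteq> U" if "openin P U \<and> f \<in> U" for U f
      using near that by (elim conjE)
  qed (fact ctbl)
qed

text \<open>
  Continuity at a point outside \<open>U\<close> holds because a compact subset of \<open>U\<close> is closed in all of \<open>X\<close>,
  so such a point has a neighbourhood that misses it.
\<close>

lemma continuous_map_collapse_outside_open:
  assumes "Hausdorff_space X" and U: "openin X U"
  shows "continuous_map X (Alexandroff_compactification (subtopology X U))
           (\<lambda>x. if x \<in> U then Some x else None)" (is "continuous_map X ?A ?c")
  unfolding continuous_map
proof (intro conjI allI impI)
  have UX: "U \<subseteq> topspace X"
    using U openin_subset by blast
  then show "?c ` topspace X \<subseteq> topspace ?A"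
    by auto
  fix W assume "openin ?A W"
  then consider V where "openin (subtopology X U) V" "W = Some ` V"
    | C where "compactin (subtopology X U) C" "W = insert None (Some ` (topspace (subtopology X U) - C))"
    unfolding openin_Alexandroff_compactification by blast
  then show "openin X {x \<in> topspace X. ?c x \<in> W}"
  proof cases
    case 1
    then have "openin X V" "V \<subseteq> U"
      using U by (simp_all add: openin_open_subtopology)
    moreover have "{x \<in> topspace X. ?c x \<in> W} = V"
      using 1 UX \<open>V \<subseteq> U\<close> by auto
    ultimately show ?thesis
      by simp
  next
    case 2
    then have "compactin X C" "C \<subseteq> U"
      by (simp_all add: compactin_subtopology)
    then have "closedin X C"
      using assms(1) compactin_imp_closedin by blast
    moreover have "{x \<in> topspace X. ?c x \<in> W} = topspace X - C"
      using 2(2) UX \<open>C \<subseteq> U\<close> by auto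
    ultimately show ?thesis
      by (simp add: openin_diff)
  qed
qed


section \<open>Transformation groupoids\<close>

text \<open>
  The germs $[s,z]$ and the bisections $[s,U]$ are determined by the multiplication of $S$ and the
  family of sets $Z_e$. What makes the bisections a base is that $e \mapsto Z_e$ is a homomorphism
  from the idempotents to the open sets under intersection.
\<close>

locale action_with_open_domains =
  fixes Z :: "'z topology" and \<theta> :: "'s::inverse_semigroup \<Rightarrow> 'z \<rightharpoonup> 'z"
  assumes open_fixed_part: "e \<in> idempotents \<Longrightarrow> openin Z (fixed_part \<theta> e)"
    and fixed_part_mult: "e \<in> idempotents \<Longrightarrow> f \<in> idempotents \<Longrightarrow>
      fixed_part \<theta> (e * f) = fixed_part \<theta> e \<inter> fixed_part \<theta> f"
    and fixed_part_cover: "(\<Union>e\<in>idempotents. fixed_part \<theta> e) = topspace Z"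
begin

abbreviation G where "G \<equiv> transformation_groupoid Z \<theta>"

lemma equiv_germ_rel: "equiv (germ_pairs \<theta>) (germ_rel \<theta>)"
proof (rule equivI)
  show "germ_rel \<theta> \<subseteq> germ_pairs \<theta> \<times> germ_pairs \<theta>"
    by (auto simp: germ_rel_def)
  show "refl_on (germ_pairs \<theta>) (germ_rel \<theta>)"
    using star_mult_idempotent by (auto simp: refl_on_def germ_rel_def germ_pairs_def)
  show "sym (germ_rel \<theta>)"
    unfolding sym_def germ_rel_def by auto metis
  show "trans (germ_rel \<theta>)"
  proof (rule transI)
    fix p q r assume "(p, q) \<in> germ_rel \<theta>" "(q, r) \<in> germ_rel \<theta>"
    then obtain s t u z e f where pqr: "p = (s, z)" "q = (t, z)" "r = (u, z)"
        "p \<in> germ_pairs \<theta>" "r \<in> germ_pairs \<theta>"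
      and e: "e \<in> idempotents" "s * e = t * e" "z \<in> fixed_part \<theta> e"
      and f: "f \<in> idempotents" "t * f = u * f" "z \<in> fixed_part \<theta> f"
      unfolding germ_rel_def by auto
    have "s * (e * f) = u * (e * f)"
      by (metis e(1,2) f(1,2) idempotents_commute mult.assoc)
    moreover have "z \<in> fixed_part \<theta> (e * f)"
      using e f by (simp add: fixed_part_mult)
    ultimately show "(p, r) \<in> germ_rel \<theta>"
      using pqr idempotents_mult_closed[OF e(1) f(1)] by (auto simp: germ_rel_def)
  qed
qed

lemma germ_eq_iff:
  assumes "z \<in> fixed_part \<theta> (s\<^sup>\<star> * s)" and "w \<in> fixed_part \<theta> (t\<^sup>\<star> * t)"
  shows "germ \<theta> s z = germ \<theta> t w \<longleftrightarrow>
    z = w \<and> (\<exists>e\<in>idempotents. s * e = t * e \<and> z \<in> fixed_part \<theta> e)"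
proof -
  have "(s, z) \<in> germ_pairs \<theta>" "(t, w) \<in> germ_pairs \<theta>"
    using assms by (simp_all add: germ_pairs_def)
  then show ?thesis
    unfolding germ_def eq_equiv_class_iff[OF equiv_germ_rel \<open>(s, z) \<in> germ_pairs \<theta>\<close> \<open>(t, w) \<in> germ_pairs \<theta>\<close>]
    by (simp add: germ_rel_def)
qed

lemma source_germ:
  assumes "z \<in> fixed_part \<theta> (s\<^sup>\<star> * s)"
  shows "source G (germ \<theta> s z) = z"
proof -
  have "(s, z) \<in> germ \<theta> s z"
    using equiv_class_self[OF equiv_germ_rel] assms by (simp add: germ_def germ_pairs_def)
  moreover have "y = z" if "(t, y) \<in> germ \<theta> s z" for t y
    using that by (auto simp: germ_def germ_rel_def)
  ultimately show ?thesis
    unfolding transformation_groupoid_def by (auto intro!: the_equality)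
qed

lemma open_bisection:
  assumes "openin Z U" and "U \<subseteq> fixed_part \<theta> (s\<^sup>\<star> * s)"
  shows "openin (arrows G) (germ \<theta> s ` U)"
  unfolding transformation_groupoid_def topological_groupoid.simps
  by (rule topology_generated_by_Basis) (use assms in blast)

lemma open_fixed_part_Int:
  assumes "openin Z U" and "e \<in> idempotents"
  shows "openin Z (U \<inter> fixed_part \<theta> e)"
  using assms open_fixed_part by (simp add: openin_Int)

text \<open>
  Around each of its points, the intersection of two bisections contains a third: if
  $[s,z] = [t,z]$, this is witnessed by an idempotent $e$ with $z \in Z_e$, and then $s$ and $t$ have equal germs at
  every point of $Z_e$ where both are defined.
\<close>

lemma bisections_form_basis:
  assumes W: "openin (arrows G) W" and g: "g \<in> W"
  obtains s U z where "openin Z U" "U \<subseteq> fixed_part \<theta> (s\<^sup>\<star> * s)"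
    "z \<in> U" "g = germ \<theta> s z" "germ \<theta> s ` U \<subseteq> W"
proof -
  have "generate_topology_on {germ \<theta> s ` U | s U. openin Z U \<and> U \<subseteq> fixed_part \<theta> (s\<^sup>\<star> * s)} W"
    using W unfolding transformation_groupoid_def topological_groupoid.simps
    by (rule openin_topology_generated_by)
  then have "\<exists>s U z. openin Z U \<and> U \<subseteq> fixed_part \<theta> (s\<^sup>\<star> * s) \<and>
    z \<in> U \<and> g = germ \<theta> s z \<and> germ \<theta> s ` U \<subseteq> W"
    using g
  proof induction
    case (Int a b)
    then have g: "g \<in> a" "g \<in> b"
      by auto
    obtain s U z where
      s: "openin Z U" "U \<subseteq> fixed_part \<theta> (s\<^sup>\<star> * s)" "z \<in> U" "g = germ \<theta> s z" "germ \<theta> s ` U \<subseteq> a"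
      using Int.IH(1)[OF g(1)] by (elim exE conjE)
    obtain t V w where
      t: "openin Z V" "V \<subseteq> fixed_part \<theta> (t\<^sup>\<star> * t)" "w \<in> V" "g = germ \<theta> t w" "germ \<theta> t ` V \<subseteq> b"
      using Int.IH(2)[OF g(2)] by (elim exE conjE)
    have "germ \<theta> s z = germ \<theta> t w"
      using s(4) t(4) by simp
    then obtain e where e: "z = w" "e \<in> idempotents" "s * e = t * e" "z \<in> fixed_part \<theta> e"
      using germ_eq_iff[OF subsetD[OF s(2,3)] subsetD[OF t(2,3)]] by auto
    define U' where "U' = U \<inter> V \<inter> fixed_part \<theta> e"
    have eq: "germ \<theta> s y = germ \<theta> t y" if "y \<in> U'" for y
      using that s(2) t(2) e germ_eq_iff[of y s y t] by (auto simp: U'_def)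
    have "openin Z U'"
      using s(1) t(1) e(2) by (simp add: U'_def open_fixed_part_Int openin_Int)
    moreover have "germ \<theta> s ` U' \<subseteq> a \<inter> b"
    proof
      fix h assume "h \<in> germ \<theta> s ` U'"
      then obtain y where y: "y \<in> U'" "h = germ \<theta> s y"
        by auto
      then show "h \<in> a \<inter> b"
        using s(5) t(5) eq[OF y(1)] by (auto simp: U'_def)
    qed
    moreover have "z \<in> U'" "U' \<subseteq> fixed_part \<theta> (s\<^sup>\<star> * s)"
      using s t e by (auto simp: U'_def)
    ultimately show ?case
      using s(4) by auto
  next
    case (UN K)
    then obtain k where "k \<in> K" "g \<in> k"
      by auto
    with UN.IH[of k] show ?case
      by (meson Union_upper order_trans)
  next
    case (Basis b)
    then show ?case
      by auto
  qed auto
  then show thesis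
    using that by metis
qed

lemma arrow_cases:
  assumes "g \<in> topspace (arrows G)"
  obtains s z where "z \<in> fixed_part \<theta> (s\<^sup>\<star> * s)" "g = germ \<theta> s z"
  using bisections_form_basis[OF openin_topspace assms] by (metis subsetD)

text \<open>
  The source map carries each bisection $[s,U]$ onto the open set $U$, so it is continuous and open;
  it is surjective because the sets $Z_e$ cover $Z$.
\<close>

lemma second_countable_units:
  assumes "second_countable (arrows G)"
  shows "second_countable Z"
proof (rule second_countable_open_map_image[of "arrows G" Z "source G"])
  have germ_arrow: "germ \<theta> s z \<in> topspace (arrows G)" if "z \<in> fixed_part \<theta> (s\<^sup>\<star> * s)" for s z
    using that openin_subset[OF open_bisection[OF open_fixed_part[OF star_mult_idempotent] order_refl]]
    by blast
  show img: "source G ` topspace (arrows G) = topspace Z"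
  proof (intro equalityI subsetI)
    fix z assume "z \<in> source G ` topspace (arrows G)"
    then obtain g where g: "g \<in> topspace (arrows G)" "z = source G g"
      by auto
    obtain s w where "w \<in> fixed_part \<theta> (s\<^sup>\<star> * s)" "g = germ \<theta> s w"
      using arrow_cases[OF g(1)] .
    then have "z \<in> fixed_part \<theta> (s\<^sup>\<star> * s)"
      using source_germ g(2) by simp
    then show "z \<in> topspace Z"
      using fixed_part_cover star_mult_idempotent by blast
  next
    fix z assume "z \<in> topspace Z"
    then obtain e where "e \<in> idempotents" "z \<in> fixed_part \<theta> e"
      using fixed_part_cover by blast
    then have "z \<in> fixed_part \<theta> (e\<^sup>\<star> * e)"
      by (simp add: star_mult_self_idempotent)
    then show "z \<in> source G ` topspace (arrows G)"
      using germ_arrow[of z e] source_germ[of z e] by (simp add: rev_image_eqI)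
  qed
  show "open_map (arrows G) Z (source G)"
    unfolding open_map_def
  proof (intro allI impI)
    fix W assume W: "openin (arrows G) W"
    show "openin Z (source G ` W)"
    proof (subst openin_subopen, intro ballI)
      fix y assume "y \<in> source G ` W"
      then obtain g where "g \<in> W" "y = source G g"
        by auto
      obtain s U z where U: "openin Z U" "U \<subseteq> fixed_part \<theta> (s\<^sup>\<star> * s)"
          "z \<in> U" "g = germ \<theta> s z" "germ \<theta> s ` U \<subseteq> W"
        using bisections_form_basis[OF W \<open>g \<in> W\<close>] .
      have "source G (germ \<theta> s x) = x" if "x \<in> U" for x
        using that U(2) source_germ by blast
      then have "U \<subseteq> source G ` W" "y = z"
        using U(3-5) \<open>y = source G g\<close> by (force simp: image_iff)+
      then show "\<exists>T. openin Z T \<and> y \<in> T \<and> T \<subseteq> source G ` W"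
        using U by blast
    qed
  qed
  show "continuous_map (arrows G) Z (source G)"
    unfolding continuous_map
  proof (intro conjI allI impI)
    fix U assume U: "openin Z U"
    have "{g \<in> topspace (arrows G). source G g \<in> U} =
        (\<Union>s. germ \<theta> s ` (U \<inter> fixed_part \<theta> (s\<^sup>\<star> * s)))"
    proof (intro equalityI subsetI)
      fix g assume "g \<in> {g \<in> topspace (arrows G). source G g \<in> U}"
      then have g: "g \<in> topspace (arrows G)" "source G g \<in> U"
        by simp_all
      obtain s z where "z \<in> fixed_part \<theta> (s\<^sup>\<star> * s)" "g = germ \<theta> s z"
        using arrow_cases[OF g(1)] .
      then show "g \<in> (\<Union>s. germ \<theta> s ` (U \<inter> fixed_part \<theta> (s\<^sup>\<star> * s)))"
        using g(2) source_germ by auto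
    next
      fix g assume "g \<in> (\<Union>s. germ \<theta> s ` (U \<inter> fixed_part \<theta> (s\<^sup>\<star> * s)))"
      then show "g \<in> {g \<in> topspace (arrows G). source G g \<in> U}"
        using germ_arrow source_germ by auto
    qed
    moreover have "openin (arrows G) (germ \<theta> s ` (U \<inter> fixed_part \<theta> (s\<^sup>\<star> * s)))" for s
      using U by (intro open_bisection open_fixed_part_Int star_mult_idempotent) auto
    ultimately show "openin (arrows G) {g \<in> topspace (arrows G). source G g \<in> U}"
      by auto
  qed (use img in simp)
qed fact

lemma second_countable_arrows:
  assumes "second_countable Z" and A: "countable {s. fixed_part \<theta> (s\<^sup>\<star> * s) \<noteq> {}}"
  shows "second_countable (arrows G)"
proof -
  obtain B where B: "countable B" "\<And>V. V \<in> B \<Longrightarrow> openin Z V"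
    and base: "\<And>U x. openin Z U \<Longrightarrow> x \<in> U \<Longrightarrow> \<exists>V\<in>B. x \<in> V \<and> V \<subseteq> U"
    using assms(1) unfolding second_countable_def by metis
  define N where "N = (\<lambda>(s, V). germ \<theta> s ` (V \<inter> fixed_part \<theta> (s\<^sup>\<star> * s)))"
  let ?base = "N ` ({s. fixed_part \<theta> (s\<^sup>\<star> * s) \<noteq> {}} \<times> B)"
  have "countable ?base"
    using A B(1) by simp
  moreover have "openin (arrows G) W" if W: "W \<in> ?base" for W
  proof -
    obtain s V where sV: "W = germ \<theta> s ` (V \<inter> fixed_part \<theta> (s\<^sup>\<star> * s))" "V \<in> B"
      using W by (auto simp: N_def)
    show ?thesis
      unfolding sV(1) using B(2)[OF sV(2)]
      by (intro open_bisection open_fixed_part_Int star_mult_idempotent) auto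
  qed
  moreover have "\<exists>V\<in>?base. g \<in> V \<and> V \<subseteq> W" if W: "openin (arrows G) W" "g \<in> W" for W g
  proof -
    obtain s U z where U: "openin Z U" "U \<subseteq> fixed_part \<theta> (s\<^sup>\<star> * s)"
        "z \<in> U" "g = germ \<theta> s z" "germ \<theta> s ` U \<subseteq> W"
      using bisections_form_basis[OF W] .
    obtain V where V: "V \<in> B" "z \<in> V" "V \<subseteq> U"
      using base[OF U(1,3)] by auto
    have "N (s, V) \<in> ?base"
      using U V by (intro imageI) auto
    moreover have "g \<in> N (s, V)" "N (s, V) \<subseteq> W"
      using U V by (auto simp: N_def)
    ultimately show ?thesis
      by (intro bexI[of _ "N (s, V)"] conjI)
  qed
  ultimately show ?thesis
    unfolding second_countable_def by (intro exI[of _ ?base] conjI allI impI ballI) simp_all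
qed

text \<open>
  The point \<open>z s\<close> lies in as few of the sets $Z_f$ as the condition $z_s \in Z_{s^*s}$ permits.
  Equality of the germs of \<open>s\<close> and \<open>t\<close> at \<open>z s\<close> is then witnessed by an idempotent above $s^*s$, which
  gives $s \le t$. If one basic open set could be chosen for both \<open>s\<close> and \<open>t\<close>, then $s \le t$ and
  $t \le s$, so the choice of basic open sets is injective.
\<close>

lemma countable_if_principal_points:
  assumes "second_countable (arrows G)"
    and z: "\<And>s. s \<in> A \<Longrightarrow> z s \<in> fixed_part \<theta> (s\<^sup>\<star> * s)"
    and principal: "\<And>s f. s \<in> A \<Longrightarrow> f \<in> idempotents \<Longrightarrow> z s \<in> fixed_part \<theta> f \<Longrightarrow> s\<^sup>\<star> * s \<preceq> f"
  shows "countable A"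
proof -
  obtain B where B: "countable B"
    and base: "\<And>U x. openin (arrows G) U \<Longrightarrow> x \<in> U \<Longrightarrow> \<exists>V\<in>B. x \<in> V \<and> V \<subseteq> U"
    using assms(1) unfolding second_countable_def by metis
  define D where "D s = germ \<theta> s ` fixed_part \<theta> (s\<^sup>\<star> * s)" for s
  have "\<exists>V\<in>B. germ \<theta> s (z s) \<in> V \<and> V \<subseteq> D s" if "s \<in> A" for s
    unfolding D_def using that z
    by (intro base open_bisection open_fixed_part star_mult_idempotent) auto
  then obtain N where N: "\<And>s. s \<in> A \<Longrightarrow> N s \<in> B \<and> germ \<theta> s (z s) \<in> N s \<and> N s \<subseteq> D s"
    by metis
  \<comment> \<open>The second equation says $s \le t$, the first one that $s^*s \le t^*t$.\<close>
  have below: "t\<^sup>\<star> * t * (s\<^sup>\<star> * s) = s\<^sup>\<star> * s \<and> s = t * (s\<^sup>\<star> * s)"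
    if s: "s \<in> A" and st: "germ \<theta> s (z s) \<in> D t" for s t
  proof -
    obtain w where w: "w \<in> fixed_part \<theta> (t\<^sup>\<star> * t)" "germ \<theta> s (z s) = germ \<theta> t w"
      using st by (auto simp: D_def)
    then obtain f where f: "w = z s" "f \<in> idempotents" "s * f = t * f" "z s \<in> fixed_part \<theta> f"
      using germ_eq_iff[OF z[OF s] w(1)] by metis
    have fs: "f * (s\<^sup>\<star> * s) = s\<^sup>\<star> * s"
      using principal[OF s f(2,4)] by (simp add: nat_le_idempotent star_mult_idempotent)
    have "s = s * (s\<^sup>\<star> * s)"
      by (simp add: star_inverse mult.assoc[symmetric])
    also have "\<dots> = t * (s\<^sup>\<star> * s)"
      using f(3) fs by (metis mult.assoc)
    finally have "s = t * (s\<^sup>\<star> * s)" .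
    moreover have "t\<^sup>\<star> * t * (s\<^sup>\<star> * s) = s\<^sup>\<star> * s"
      using principal[OF s star_mult_idempotent] w(1) f(1)
      by (simp add: nat_le_idempotent star_mult_idempotent)
    ultimately show ?thesis
      by simp
  qed
  have "inj_on N A"
  proof (rule inj_onI)
    fix s t assume st: "s \<in> A" "t \<in> A" "N s = N t"
    then have "germ \<theta> s (z s) \<in> D t" "germ \<theta> t (z t) \<in> D s"
      using N by blast+
    then have *: "t\<^sup>\<star> * t * (s\<^sup>\<star> * s) = s\<^sup>\<star> * s" "s = t * (s\<^sup>\<star> * s)"
        "s\<^sup>\<star> * s * (t\<^sup>\<star> * t) = t\<^sup>\<star> * t"
      using below st by blast+
    then have "s\<^sup>\<star> * s = t\<^sup>\<star> * t"
      using idempotents_commute[OF star_mult_idempotent star_mult_idempotent, of s t] by simp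
    then show "s = t"
      using *(2) star_inverse(1)[of t] by (simp add: mult.assoc)
  qed
  moreover have "N ` A \<subseteq> B"
    using N by auto
  ultimately show ?thesis
    using B by (meson countable_image_inj_on countable_subset)
qed

end


section \<open>The Khoshkam-Skandalis space\<close>

locale inverse_semigroup_action =
  fixes X :: "'x topology" and \<theta> :: "'s::inverse_semigroup \<Rightarrow> 'x \<rightharpoonup> 'x"
  assumes haus: "Hausdorff_space X"
    and action: "is_action X \<theta>"
begin

abbreviation "Z \<equiv> KS_space X \<theta>"

lemma fixed_part_open: "e \<in> idempotents \<Longrightarrow> openin X (fixed_part \<theta> e)"
  using action by (simp add: is_action_def)

text \<open>
  An idempotent acts as the identity on its whole domain: if $\theta_f(x) = y$, then also
  $\theta_f(y) = y$, and injectivity gives $y = x$.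
\<close>

lemma fixed_part_mult:
  assumes "e \<in> idempotents" and "f \<in> idempotents"
  shows "fixed_part \<theta> (e * f) = fixed_part \<theta> e \<inter> fixed_part \<theta> f"
proof -
  have comp: "\<theta> (s * t) = \<theta> s \<circ>\<^sub>m \<theta> t" and inj: "inj_on (\<theta> s) (dom (\<theta> s))" for s t
    using action by (simp_all add: is_action_def partial_bijection_def)
  have "x \<in> fixed_part \<theta> f" if "\<theta> f x = Some y" for x y
  proof -
    have "\<theta> f y = \<theta> f x"
      using comp[of f f] assms(2) that by (simp add: idempotents_def) (metis map_comp_simps(2))
    then have "y = x"
      using inj[of f] that by (auto simp: inj_on_def dom_def)
    then show ?thesis
      using that by (simp add: fixed_part_def)
  qed
  then show ?thesis
    unfolding fixed_part_def comp by (fastforce simp: map_comp_Some_iff)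
qed

lemma fixed_part_mono:
  assumes "e \<in> idempotents" and "f \<in> idempotents" and "e \<preceq> f"
  shows "fixed_part \<theta> e \<subseteq> fixed_part \<theta> f"
  using fixed_part_mult[OF assms(2,1)] assms(1,3) by (auto simp: nat_le_idempotent)

lemma KS_space_iff:
  "\<tau> \<in> topspace Z \<longleftrightarrow> \<tau> \<in> extensional idempotents \<and>
    (\<forall>e\<in>idempotents. \<forall>x. \<tau> e = Some x \<longrightarrow> x \<in> fixed_part \<theta> e) \<and>
    (\<forall>e1\<in>idempotents. \<forall>e2\<in>idempotents. e1 \<preceq> e2 \<and> \<tau> e1 \<noteq> None \<longrightarrow> \<tau> e2 = \<tau> e1) \<and>
    (\<forall>e1\<in>idempotents. \<forall>e2\<in>idempotents. \<tau> e1 \<noteq> None \<and> \<tau> e2 \<noteq> None \<longrightarrow> \<tau> (e1 * e2) \<noteq> None) \<and>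
    (\<exists>e\<in>idempotents. \<tau> e \<noteq> None)"
proof -
  have prod: "\<tau> \<in> topspace (KS_product X \<theta>) \<longleftrightarrow> \<tau> \<in> extensional idempotents \<and>
    (\<forall>e\<in>idempotents. \<forall>x. \<tau> e = Some x \<longrightarrow> x \<in> fixed_part \<theta> e)"
  proof -
    have "a \<in> topspace (Alexandroff_compactification (subtopology X (fixed_part \<theta> e)))
        \<longleftrightarrow> (\<forall>x. a = Some x \<longrightarrow> x \<in> fixed_part \<theta> e)" if "e \<in> idempotents" for e a
      using openin_subset[OF fixed_part_open[OF that]] by (cases a) auto
    then show ?thesis
      unfolding KS_product_def topspace_product_topology by (auto simp: PiE_iff)
  qed
  have infinity: "\<tau> = KS_infinity \<longleftrightarrow> (\<forall>e\<in>idempotents. \<tau> e = None)" if "\<tau> \<in> extensional idempotents"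
    using that by (auto simp: KS_infinity_def extensional_def)
  have "topspace Z = KS_tilde X \<theta> - {KS_infinity}"
    by (auto simp: KS_space_def KS_tilde_def)
  then show ?thesis
    unfolding KS_tilde_def
    by (cases "\<tau> \<in> extensional idempotents") (simp_all only: Diff_iff mem_Collect_eq prod infinity
      singleton_iff simp_thms ball_simps conj_assoc)
qed

lemma KS_coordinate:
  assumes "\<tau> \<in> topspace Z" and "e \<in> idempotents" and "\<tau> e = Some x"
  shows "x \<in> fixed_part \<theta> e"
  using assms by (simp add: KS_space_iff)

lemma KS_some_coordinate:
  assumes "\<tau> \<in> topspace Z"
  obtains e x where "e \<in> idempotents" and "\<tau> e = Some x"
proof -
  have "\<exists>e\<in>idempotents. \<tau> e \<noteq> None"
    using assms unfolding KS_space_iff by (elim conjE)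
  then show thesis
    using that by auto
qed

lemma KS_coordinate_mono:
  assumes "\<tau> \<in> topspace Z" and "e \<in> idempotents" and "f \<in> idempotents"
    and "e \<preceq> f" and "\<tau> e \<noteq> None"
  shows "\<tau> f = \<tau> e"
  using assms unfolding KS_space_iff by blast

text \<open>
  All finite coordinates of a point of $X^{KS}$ agree: two of them agree with the one at the product,
  which lies below both.
\<close>

lemma KS_coordinate_mult:
  assumes \<tau>: "\<tau> \<in> topspace Z" and e: "e \<in> idempotents" and f: "f \<in> idempotents"
  shows "\<tau> (e * f) = (if \<tau> e = None then None else if \<tau> f = None then None else \<tau> e)"
    and "\<tau> (e * f) \<noteq> None \<Longrightarrow> \<tau> f = \<tau> e"
proof -
  note ef = idempotents_mult_closed[OF e f] idempotents_mult_nat_le[OF e f]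
  have "\<tau> (e * f) = \<tau> e" "\<tau> (e * f) = \<tau> f" if "\<tau> (e * f) \<noteq> None"
    using that KS_coordinate_mono[OF \<tau> ef(1) e ef(2)] KS_coordinate_mono[OF \<tau> ef(1) f ef(3)] by simp_all
  note defined = this
  have "\<forall>e1\<in>idempotents. \<forall>e2\<in>idempotents. \<tau> e1 \<noteq> None \<and> \<tau> e2 \<noteq> None \<longrightarrow> \<tau> (e1 * e2) \<noteq> None"
    using \<tau> unfolding KS_space_iff by (elim conjE)
  from bspec[OF bspec[OF this e] f]
  have both: "\<tau> (e * f) \<noteq> None" if "\<tau> e \<noteq> None" "\<tau> f \<noteq> None"
    using that by (rule mp[OF _ conjI])
  show "\<tau> (e * f) = (if \<tau> e = None then None else if \<tau> f = None then None else \<tau> e)"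
  proof (cases "\<tau> (e * f) = None")
    case True
    with both show ?thesis
      by auto
  next
    case False
    with defined[OF False] show ?thesis
      by simp
  qed
  show "\<tau> f = \<tau> e" if "\<tau> (e * f) \<noteq> None"
    using defined[OF that] by simp
qed

lemma KS_coordinate_unique:
  assumes "\<tau> \<in> topspace Z" and "e \<in> idempotents" and "f \<in> idempotents"
    and "\<tau> e = Some x" and "\<tau> f = Some y"
  shows "x = y"
  using KS_coordinate_mult[OF assms(1-3)] assms(4,5) by simp

text \<open>
  At an idempotent $e$ the formula for the action gives $\theta_{fe}(\tau(fe))$ in coordinate $f$.
  If $\tau(e)$ is finite, then $\tau(fe)$ equals $\tau(f)$, finite or not, and $\theta_{fe}$ fixes it
  when it is finite.
\<close>

lemma fixed_part_KS_action:
  assumes e: "e \<in> idempotents"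
  shows "fixed_part (KS_action X \<theta>) e = {\<tau> \<in> topspace Z. \<tau> e \<noteq> None}"
proof -
  have ee: "e\<^sup>\<star> * e = e"
    using e by (rule star_mult_self_idempotent)
  have "KS_action X \<theta> e \<tau> = Some \<tau>" if \<tau>: "\<tau> \<in> topspace Z" "\<tau> e \<noteq> None" for \<tau>
  proof -
    have "(\<lambda>f\<in>idempotents. case \<tau> (e\<^sup>\<star> * f * e) of None \<Rightarrow> None | Some x \<Rightarrow> \<theta> (f * e) x) = \<tau>"
    proof (rule extensionalityI)
      show "\<tau> \<in> extensional idempotents"
        using \<tau>(1) by (simp add: KS_space_iff)
      fix f :: 's assume f: "f \<in> idempotents"
      have efe: "e\<^sup>\<star> * f * e = f * e"
        unfolding star_idempotent[OF e] idempotents_commute[OF e f]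
        using e by (simp add: idempotents_def mult.assoc)
      have fe: "f * e \<in> idempotents"
        using e f by (rule idempotents_mult_closed[rotated])
      show "(\<lambda>f\<in>idempotents. case \<tau> (e\<^sup>\<star> * f * e) of None \<Rightarrow> None | Some x \<Rightarrow> \<theta> (f * e) x) f = \<tau> f"
      proof (cases "\<tau> (f * e)")
        case None
        then show ?thesis
          using KS_coordinate_mult(1)[OF \<tau>(1) f e] \<tau>(2) f efe by (auto split: if_splits)
      next
        case (Some x)
        then have "\<tau> f = Some x" "\<theta> (f * e) x = Some x"
          using KS_coordinate_mult(1)[OF \<tau>(1) f e] KS_coordinate[OF \<tau>(1) fe]
          by (auto simp: fixed_part_def split: if_splits)
        then show ?thesis
          using Some f efe by simp
      qed
    qed (rule restrict_extensional)
    then show ?thesis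
      using \<tau> ee by (simp add: KS_action_def)
  qed
  then show ?thesis
    using ee by (auto simp: fixed_part_def KS_action_def split: if_splits)
qed

lemma open_KS_coordinate:
  assumes e: "e \<in> idempotents" and V: "openin X V"
  shows "openin Z {\<tau> \<in> topspace Z. \<tau> e \<in> Some ` (V \<inter> fixed_part \<theta> e)}"
proof -
  have "continuous_map Z (Alexandroff_compactification (subtopology X (fixed_part \<theta> e))) (\<lambda>\<tau>. \<tau> e)"
    unfolding KS_space_def KS_product_def
    by (intro continuous_map_from_subtopology continuous_map_product_projection e)
  moreover have "openin (Alexandroff_compactification (subtopology X (fixed_part \<theta> e)))
      (Some ` (V \<inter> fixed_part \<theta> e))"
    using V by (simp add: openin_subtopology_Int)
  ultimately show ?thesis
    by (rule openin_continuous_map_preimage)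
qed

sublocale KS: action_with_open_domains Z "KS_action X \<theta>"
proof
  fix e :: 's assume e: "e \<in> idempotents"
  have "{\<tau> \<in> topspace Z. \<tau> e \<noteq> None} =
      {\<tau> \<in> topspace Z. \<tau> e \<in> Some ` (topspace X \<inter> fixed_part \<theta> e)}"
    using KS_coordinate[OF _ e] openin_subset[OF fixed_part_open[OF e]] by auto
  then show "openin Z (fixed_part (KS_action X \<theta>) e)"
    using open_KS_coordinate[OF e openin_topspace] by (simp add: fixed_part_KS_action[OF e])
  fix f :: 's assume f: "f \<in> idempotents"
  show "fixed_part (KS_action X \<theta>) (e * f) =
      fixed_part (KS_action X \<theta>) e \<inter> fixed_part (KS_action X \<theta>) f"
    unfolding fixed_part_KS_action[OF e] fixed_part_KS_action[OF f]
      fixed_part_KS_action[OF idempotents_mult_closed[OF e f]]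
  proof (intro set_eqI)
    fix \<tau>
    show "\<tau> \<in> {\<tau> \<in> topspace Z. \<tau> (e * f) \<noteq> None} \<longleftrightarrow>
        \<tau> \<in> {\<tau> \<in> topspace Z. \<tau> e \<noteq> None} \<inter> {\<tau> \<in> topspace Z. \<tau> f \<noteq> None}"
      using KS_coordinate_mult(1)[of \<tau>, OF _ e f] by (cases "\<tau> \<in> topspace Z") simp_all
  qed
next
  show "(\<Union>e\<in>idempotents. fixed_part (KS_action X \<theta>) e) = topspace Z"
  proof (intro equalityI subsetI)
    fix \<tau> assume \<tau>: "\<tau> \<in> topspace Z"
    obtain e x where "e \<in> idempotents" "\<tau> e = Some x"
      using KS_some_coordinate[OF \<tau>] .
    then show "\<tau> \<in> (\<Union>e\<in>idempotents. fixed_part (KS_action X \<theta>) e)"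
      using \<tau> by (intro UN_I[of e]) (simp_all add: fixed_part_KS_action)
  qed (auto simp: fixed_part_KS_action)
qed

text \<open>
  When $F$ is a filter of idempotents $e$ with $x \in X_e$, this is the point of $X^{KS}$ that $F$ and
  $x$ determine. The largest such filter gives the copy of $x$ in $X^{KS}$; the principal filters give
  the points at which distinct elements of $S^X$ are told apart.
\<close>

definition filter_point :: "'s set \<Rightarrow> 'x \<Rightarrow> 's \<Rightarrow> 'x option"
  where "filter_point F x = (\<lambda>e\<in>idempotents. if e \<in> F then Some x else None)"

lemma filter_point_in_KS_space:
  assumes "e \<in> idempotents" "e \<in> F"
    and up: "\<And>e f. e \<in> idempotents \<Longrightarrow> f \<in> idempotents \<Longrightarrow> e \<in> F \<Longrightarrow> e \<preceq> f \<Longrightarrow> f \<in> F"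
    and mult: "\<And>e f. e \<in> idempotents \<Longrightarrow> f \<in> idempotents \<Longrightarrow> e \<in> F \<Longrightarrow> f \<in> F \<Longrightarrow> e * f \<in> F"
    and x: "\<And>e. e \<in> idempotents \<Longrightarrow> e \<in> F \<Longrightarrow> x \<in> fixed_part \<theta> e"
  shows "filter_point F x \<in> topspace Z"
  unfolding KS_space_iff
proof (intro conjI ballI allI impI)
  show "\<exists>e\<in>idempotents. filter_point F x e \<noteq> None"
    using assms(1,2) by (auto simp: filter_point_def)
  show "filter_point F x \<in> extensional idempotents"
    by (simp add: filter_point_def)
  have fp: "filter_point F x e = (if e \<in> F then Some x else None)" if "e \<in> idempotents" for e
    using that by (simp add: filter_point_def)
  show "y \<in> fixed_part \<theta> e" if "e \<in> idempotents" "filter_point F x e = Some y" for e y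
    using that x[of e] by (simp add: fp split: if_splits)
  show "filter_point F x f = filter_point F x e"
    if "e \<in> idempotents" "f \<in> idempotents" "e \<preceq> f \<and> filter_point F x e \<noteq> None" for e f
    using that up[OF that(1,2)] by (simp add: fp split: if_splits)
  show "filter_point F x (e * f) \<noteq> None"
    if "e \<in> idempotents" "f \<in> idempotents" "filter_point F x e \<noteq> None \<and> filter_point F x f \<noteq> None" for e f
    using that mult[OF that(1,2)] by (simp add: fp idempotents_mult_closed split: if_splits)
qed

text \<open>
  The coordinate $e$ of the section $X \to X^{KS}$ collapses the complement of $X_e$ to infinity, which
  is a continuous map on $X$. The retraction is continuous because near $\tau$ it is the coordinate
  map at any $e$ with $\tau(e)$ finite.
\<close>

lemma retraction_KS_space:
  obtains r where "retraction_map Z X r"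
proof -
  define r where "r \<tau> = (THE x. \<exists>e\<in>idempotents. \<tau> e = Some x)" for \<tau> :: "'s \<Rightarrow> 'x option"
  define j where "j x = filter_point {e. x \<in> fixed_part \<theta> e} x" for x
  have r: "r \<tau> = x" if "\<tau> \<in> topspace Z" "e \<in> idempotents" "\<tau> e = Some x" for \<tau> e x
    unfolding r_def using that KS_coordinate_unique by (intro the_equality) blast+
  have cover: "\<exists>e\<in>idempotents. x \<in> fixed_part \<theta> e" if "x \<in> topspace X" for x
    using action that unfolding is_action_def by blast
  have j: "j x \<in> topspace Z" if x: "x \<in> topspace X" for x
  proof -
    obtain e where "e \<in> idempotents" "x \<in> fixed_part \<theta> e"
      using cover[OF x] by auto
    then show ?thesis
      unfolding j_def using fixed_part_mono by (intro filter_point_in_KS_space) (auto simp: fixed_part_mult)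
  qed
  have "continuous_map X Z j"
    unfolding KS_space_def continuous_map_in_subtopology
  proof
    show "continuous_map X (KS_product X \<theta>) j"
      unfolding KS_product_def continuous_map_componentwise
    proof (intro conjI ballI)
      show "j ` topspace X \<subseteq> extensional idempotents"
        by (auto simp: j_def filter_point_def)
      fix e :: 's assume e: "e \<in> idempotents"
      then show "continuous_map X (Alexandroff_compactification (subtopology X (fixed_part \<theta> e))) (\<lambda>x. j x e)"
        using continuous_map_collapse_outside_open[OF haus fixed_part_open[OF e]]
        by (simp add: j_def filter_point_def)
    qed
    show "j \<in> topspace X \<rightarrow> KS_tilde X \<theta> - {KS_infinity}"
      using j by (auto simp: KS_space_def)
  qed
  moreover have "continuous_map Z X r"
    unfolding continuous_map
  proof (intro conjI allI impI)
    have r_cases: "\<exists>e\<in>idempotents. \<tau> e = Some (r \<tau>) \<and> r \<tau> \<in> fixed_part \<theta> e" if \<tau>: "\<tau> \<in> topspace Z" for \<tau>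
    proof -
      obtain e x where "e \<in> idempotents" "\<tau> e = Some x"
        using KS_some_coordinate[OF \<tau>] .
      then show ?thesis
        using r[OF \<tau>] KS_coordinate[OF \<tau>] by (intro bexI[of _ e]) simp_all
    qed
    then show "r ` topspace Z \<subseteq> topspace X"
      using fixed_part_open openin_subset by blast
    fix V assume V: "openin X V"
    have "{\<tau> \<in> topspace Z. r \<tau> \<in> V} =
        (\<Union>e\<in>idempotents. {\<tau> \<in> topspace Z. \<tau> e \<in> Some ` (V \<inter> fixed_part \<theta> e)})"
      (is "?L = ?R")
    proof (intro equalityI subsetI)
      fix \<tau> assume "\<tau> \<in> ?L"
      then show "\<tau> \<in> ?R"
        using r_cases[of \<tau>] by auto
    next
      fix \<tau> assume "\<tau> \<in> ?R"
      then show "\<tau> \<in> ?L"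
        using r[of \<tau>] by auto
    qed
    then show "openin Z {\<tau> \<in> topspace Z. r \<tau> \<in> V}"
      using open_KS_coordinate[OF _ V] by auto
  qed
  moreover have "r (j x) = x" if x: "x \<in> topspace X" for x
  proof -
    obtain e where "e \<in> idempotents" "x \<in> fixed_part \<theta> e"
      using cover[OF x] by auto
    then show ?thesis
      using r[OF j[OF x], of e x] by (simp add: j_def filter_point_def)
  qed
  ultimately have "retraction_map Z X r"
    unfolding retraction_map_def retraction_maps_def by auto
  then show thesis
    using that by blast
qed

lemma second_countable_KS_space:
  assumes lc: "locally_compact_space X" and "second_countable X"
    and A: "countable {s. fixed_part \<theta> (s\<^sup>\<star> * s) \<noteq> {}}"
  shows "second_countable Z"
  unfolding KS_space_def KS_product_def
proof (intro second_countable_subtopology second_countable_product_topology)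
  fix e :: 's assume e: "e \<in> idempotents"
  show "second_countable (Alexandroff_compactification (subtopology X (fixed_part \<theta> e)))"
    using assms haus fixed_part_open[OF e]
    by (intro second_countable_Alexandroff_compactification Hausdorff_space_subtopology
          second_countable_subtopology locally_compact_space_open_subset) auto
next
  have "fixed_part \<theta> (e\<^sup>\<star> * e) \<noteq> {}"
    if e: "e \<in> idempotents"
      and "\<nexists>a. topspace (Alexandroff_compactification (subtopology X (fixed_part \<theta> e))) \<subseteq> {a}" for e
  proof -
    have "e\<^sup>\<star> * e = e"
      using e by (rule star_mult_self_idempotent)
    then show ?thesis
      using that(2) by auto
  qed
  then show "countable {e \<in> idempotents.
      \<nexists>a. topspace (Alexandroff_compactification (subtopology X (fixed_part \<theta> e))) \<subseteq> {a}}"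
    by (intro countable_subset[OF _ A]) blast
qed

text \<open>
  The filter point of the principal filter above $s^*s$ lies in $X^{KS}_f$ exactly when $s^*s \le f$.
\<close>

lemma second_countable_imp_countable:
  assumes "second_countable (arrows KS.G)"
  shows "countable {s. fixed_part \<theta> (s\<^sup>\<star> * s) \<noteq> {}}"
proof -
  define z where "z s = filter_point {f. s\<^sup>\<star> * s \<preceq> f} (SOME x. x \<in> fixed_part \<theta> (s\<^sup>\<star> * s))" for s
  have coord: "z s f \<noteq> None \<longleftrightarrow> s\<^sup>\<star> * s \<preceq> f" if "f \<in> idempotents" for s f
    using that by (simp add: z_def filter_point_def)
  have ss: "s\<^sup>\<star> * s \<preceq> s\<^sup>\<star> * s" for s :: 's
    using star_mult_idempotent[of s] by (simp add: nat_le_idempotent) (simp add: idempotents_def)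
  have zZ: "z s \<in> topspace Z" if s: "fixed_part \<theta> (s\<^sup>\<star> * s) \<noteq> {}" for s
    unfolding z_def
  proof (rule filter_point_in_KS_space)
    show "s\<^sup>\<star> * s \<in> idempotents" "s\<^sup>\<star> * s \<in> {f. s\<^sup>\<star> * s \<preceq> f}"
      using ss by (simp_all add: star_mult_idempotent)
    show "(SOME x. x \<in> fixed_part \<theta> (s\<^sup>\<star> * s)) \<in> fixed_part \<theta> e"
      if "e \<in> idempotents" "e \<in> {f. s\<^sup>\<star> * s \<preceq> f}" for e
      using that fixed_part_mono[OF star_mult_idempotent that(1)] some_in_eq[of "fixed_part \<theta> (s\<^sup>\<star> * s)"] s
      by auto
  qed (auto simp: nat_le_idempotent star_mult_idempotent, (metis mult.assoc)+)
  show ?thesis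
    using assms
  proof (rule KS.countable_if_principal_points[where z = z])
    fix s :: 's assume "s \<in> {s. fixed_part \<theta> (s\<^sup>\<star> * s) \<noteq> {}}"
    then show "z s \<in> fixed_part (KS_action X \<theta>) (s\<^sup>\<star> * s)"
      unfolding fixed_part_KS_action[OF star_mult_idempotent]
      using zZ[of s] coord[OF star_mult_idempotent, of s s] ss[of s] by simp
  next
    fix s f :: 's assume "f \<in> idempotents" "z s \<in> fixed_part (KS_action X \<theta>) f"
    then show "s\<^sup>\<star> * s \<preceq> f"
      using coord by (simp add: fixed_part_KS_action)
  qed
qed

end


section \<open>Second countability of the groupoid\<close>

theorem proposition3p1p7:
  fixes X :: "'x topology" and \<theta> :: "'s::inverse_semigroup \<Rightarrow> 'x \<rightharpoonup> 'x"
  assumes "locally_compact_space X" and "Hausdorff_space X"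
    and "is_action X \<theta>"
  shows "second_countable (arrows (KS_groupoid X \<theta>)) \<longleftrightarrow>
    second_countable X \<and> countable {s. fixed_part \<theta> (s\<^sup>\<star> * s) \<noteq> {}}"
proof -
  interpret inverse_semigroup_action X \<theta>
    by unfold_locales fact+
  have G: "KS_groupoid X \<theta> = KS.G"
    by (simp add: KS_groupoid_def)
  show ?thesis
  proof (intro iffI conjI)
    assume sc: "second_countable (arrows (KS_groupoid X \<theta>))"
    obtain r where "retraction_map Z X r"
      using retraction_KS_space by blast
    then show "second_countable X"
      using KS.second_countable_units sc second_countable_retraction_map_image unfolding G by blast
    show "countable {s. fixed_part \<theta> (s\<^sup>\<star> * s) \<noteq> {}}"
      using second_countable_imp_countable sc unfolding G by blast
  next
    assume R: "second_countable X \<and> countable {s. fixed_part \<theta> (s\<^sup>\<star> * s) \<noteq> {}}"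
    have "fixed_part \<theta> (s\<^sup>\<star> * s) \<noteq> {}" if "fixed_part (KS_action X \<theta>) (s\<^sup>\<star> * s) \<noteq> {}" for s
      using that KS_coordinate[OF _ star_mult_idempotent]
      unfolding fixed_part_KS_action[OF star_mult_idempotent] by blast
    then have "countable {s. fixed_part (KS_action X \<theta>) (s\<^sup>\<star> * s) \<noteq> {}}"
      using R by (elim conjE) (rule countable_subset[rotated], auto)
    then show "second_countable (arrows (KS_groupoid X \<theta>))"
      unfolding G using R assms(1) by (intro KS.second_countable_arrows second_countable_KS_space) auto
  qed
qed

end
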